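(* Let $d\ge 2$ be an integer, let $\Bbbk$ be an algebraically closed field of characteristic $0$ or larger than $d$, and let $\mathcal{C}\subseteq\mathbb{P}^d$ be a rational normal curve over $\Bbbk$. Let $P_1,\ldots,P_{d+1},P_1',\ldots,P_{d+1}'$ be $2d+2$ distinct points of $\mathcal{C}$. For $1\le i\le d+1$ let $\pi_i$, respectively $\pi_i'$, be the osculating hyperplane to $\mathcal{C}$ at $P_i$, respectively $P_i'$, and define the points \[ R_i=\bigcap_{j\neq i}\pi_j,\qquad R_i'=\bigcap_{j\neq i}\pi_j', \] where $j$ ranges over $\{1,\ldots,d+1\}\setminus\{i\}$. Then the points $R_1,\ldots,R_{d+1},R_1',\ldots,R_{d+1}'$ lie on a rational normal curve in $\mathbb{P}^d$.
   Context: A rational normal curve in $\mathbb{P}^d$ is an irreducible smooth rational projective curve of degree $d$ in $\mathbb{P}^d$; up to projective automorphism it is the image of $\mathbb{P}^1\to\mathbb{P}^d$, $[a:b]\mapsto[\ldots:\binom{d}{i}a^{d-i}b^i:\ldots]_{0\le i\le d}$ (not contained in a hyperplane). The osculating hyperplane to a rational normal curve $\mathcal{C}\subseteq\mathbb{P}^d$ at a point $P\in\mathcal{C}$ is the unique hyperplane meeting $\mathcal{C}$ set-theoretically only in $P$ (equivalently, meeting $\mathcal{C}$ at $P$ with multiplicity $d$). Osculating hyperplanes to $\mathcal{C}$ at any $d+1$ distinct points are in general linear position, so any $d$ of them meet in exactly one point; thus each $R_i$ and each $R_i'$ is a well-defined point. *)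

theory Defs
  imports "HOL-Computational_Algebra.Computational_Algebra" "Jordan_Normal_Form.Matrix"
begin

text \<open>
  A point of projective \<open>d\<close>-space is a one-dimensional subspace of the space of vectors
  of length \<open>d + 1\<close>; curves and hyperplanes are sets of points.
\<close>

type_synonym 'k proj_point = "'k vec set"

definition proj_class :: "'k::field vec \<Rightarrow> 'k proj_point" where
  "proj_class v = {c \<cdot>\<^sub>v v | c. True}"

definition proj_space :: "nat \<Rightarrow> 'k::field proj_point set" where
  "proj_space d = proj_class ` (carrier_vec (d + 1) - {0\<^sub>v (d + 1)})"

definition is_hyperplane :: "nat \<Rightarrow> 'k::field proj_point set \<Rightarrow> bool" where
  "is_hyperplane d H \<longleftrightarrow>
     (\<exists>a \<in> carrier_vec (d + 1) - {0\<^sub>v (d + 1)}.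
        H = {p \<in> proj_space d. \<forall>v \<in> p. a \<bullet> v = 0})"

text \<open>The invertible matrix \<open>A\<close> acts on points by taking images of subspaces.\<close>

definition is_proj_automorphism ::
  "nat \<Rightarrow> ('k::field proj_point \<Rightarrow> 'k proj_point) \<Rightarrow> bool" where
  "is_proj_automorphism d f \<longleftrightarrow>
     (\<exists>A \<in> carrier_mat (d + 1) (d + 1).
        invertible_mat A \<and> f = (\<lambda>p. (\<lambda>v. A *\<^sub>v v) ` p))"

definition veronese_vec :: "nat \<Rightarrow> 'k::field \<Rightarrow> 'k \<Rightarrow> 'k vec" where
  "veronese_vec d a b = vec (d + 1) (\<lambda>i. of_nat (d choose i) * a ^ (d - i) * b ^ i)"

definition standard_rational_normal_curve :: "nat \<Rightarrow> 'k::field proj_point set" where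
  "standard_rational_normal_curve d =
     {proj_class (veronese_vec d a b) | a b. (a, b) \<noteq> (0, 0)}"

text \<open>
  Because of the binomial coefficients, this is the usual notion only if the characteristic
  of the field is \<open>0\<close> or larger than \<open>d\<close>; otherwise the standard curve can lie in a hyperplane.
\<close>

definition rational_normal_curve :: "nat \<Rightarrow> 'k::field proj_point set \<Rightarrow> bool" where
  "rational_normal_curve d C \<longleftrightarrow>
     (\<exists>f. is_proj_automorphism d f \<and> C = f ` standard_rational_normal_curve d)"

definition osculating_hyperplane ::
  "nat \<Rightarrow> 'k::field proj_point set \<Rightarrow> 'k proj_point \<Rightarrow> 'k proj_point set" where
  "osculating_hyperplane d C p = (THE H. is_hyperplane d H \<and> H \<inter> C = {p})"

end

theory Submission
  imports Defs "Jordan_Normal_Form.Determinant"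
begin

text \<open>
  Identify a vector \<open>v\<close> with the binary form \<open>q \<mapsto> osc_vec d q \<bullet> v\<close> of degree \<open>d\<close>. Since
  \<open>osc_vec d p\<close> pairs with the curve point of parameter \<open>q\<close> to \<open>[q, p]\<^sup>d\<close>, it is the osculating
  hyperplane at \<open>p\<close>, and the point \<open>R\<^sub>i\<close> becomes the form \<open>\<Prod>\<^bsub>j\<noteq>i\<^esub> [p\<^sub>j, q]\<close>. With
  \<open>F = \<Prod>\<^sub>j [p\<^sub>j, q]\<close> and \<open>F' = \<Prod>\<^sub>j [p'\<^sub>j, q]\<close>, the Bezoutian \<open>(F(x) F'(y) - F(y) F'(x)) / [x, y]\<close>,
  as a form in \<open>x\<close>, is proportional to \<open>R\<^sub>i\<close> at \<open>y = p\<^sub>i\<close> and to \<open>R'\<^sub>i\<close> at \<open>y = p'\<^sub>i\<close>. It has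
  degree \<open>d\<close> in \<open>y\<close> and is nondegenerate because \<open>F\<close> and \<open>F'\<close> are coprime, so letting \<open>y\<close>
  vary gives the required rational normal curve.
\<close>

unbundle no Formal_Power_Series.fps_syntax

section \<open>Projective points and hyperplanes in terms of vectors\<close>

lemma proj_class_smult:
  fixes v :: "'k::field vec"
  assumes "c \<noteq> 0"
  shows "proj_class (c \<cdot>\<^sub>v v) = proj_class v"
proof -
  have "k \<cdot>\<^sub>v v = (k / c) \<cdot>\<^sub>v (c \<cdot>\<^sub>v v)" for k
    using assms by (simp add: smult_smult_assoc)
  moreover have "k \<cdot>\<^sub>v (c \<cdot>\<^sub>v v) = (k * c) \<cdot>\<^sub>v v" for k
    by (rule smult_smult_assoc)
  ultimately show ?thesis unfolding proj_class_def by blast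
qed

lemma proj_class_self: "v \<in> proj_class v"
proof -
  have "v = 1 \<cdot>\<^sub>v v" by simp
  thus ?thesis unfolding proj_class_def by blast
qed

lemma proj_class_eqD:
  assumes "proj_class v = proj_class w"
  obtains c where "v = c \<cdot>\<^sub>v w"
  using proj_class_self[of v] assms unfolding proj_class_def by auto

lemma image_proj_class:
  assumes "A \<in> carrier_mat m n" "v \<in> carrier_vec n"
  shows "(\<lambda>x. A *\<^sub>v x) ` proj_class v = proj_class (A *\<^sub>v v)"
proof -
  have "A *\<^sub>v (k \<cdot>\<^sub>v v) = k \<cdot>\<^sub>v (A *\<^sub>v v)" for k
    using assms by (rule mult_mat_vec)
  thus ?thesis unfolding proj_class_def by (auto simp: image_iff) metis
qed

lemma proj_class_in_proj_space:
  "v \<in> carrier_vec (d + 1) \<Longrightarrow> v \<noteq> 0\<^sub>v (d + 1) \<Longrightarrow> proj_class v \<in> proj_space d"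
  unfolding proj_space_def by blast

text \<open>The set from \<open>is_hyperplane\<close> with its covector made an argument, so that
  equalities and incidences of hyperplanes reduce to statements about covectors.\<close>

definition hyperplane :: "nat \<Rightarrow> 'k::field vec \<Rightarrow> 'k proj_point set" where
  "hyperplane d a = {p \<in> proj_space d. \<forall>v \<in> p. a \<bullet> v = 0}"

lemma mem_hyperplane:
  assumes "a \<in> carrier_vec (d + 1)" "v \<in> carrier_vec (d + 1)" "v \<noteq> 0\<^sub>v (d + 1)"
  shows "proj_class v \<in> hyperplane d a \<longleftrightarrow> a \<bullet> v = 0"
proof
  assume "proj_class v \<in> hyperplane d a"
  thus "a \<bullet> v = 0" using proj_class_self unfolding hyperplane_def by blast
next
  assume "a \<bullet> v = 0"
  thus "proj_class v \<in> hyperplane d a"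
    using assms proj_class_in_proj_space unfolding hyperplane_def by (auto simp: proj_class_def)
qed

lemma hyperplane_smult:
  fixes a :: "'k::field vec"
  assumes "a \<in> carrier_vec (d + 1)" "c \<noteq> 0"
  shows "hyperplane d (c \<cdot>\<^sub>v a) = hyperplane d a"
proof -
  have "(c \<cdot>\<^sub>v a) \<bullet> v = 0 \<longleftrightarrow> a \<bullet> v = 0" if "p \<in> proj_space d" "v \<in> p" for p v
  proof -
    have "v \<in> carrier_vec (d + 1)" using that unfolding proj_space_def proj_class_def by auto
    thus ?thesis using assms by simp
  qed
  thus ?thesis unfolding hyperplane_def by auto
qed

section \<open>Invertible matrices and biorthogonal families\<close>

lemma det_nonzero_inverse:
  fixes A :: "'k::field mat"
  assumes "A \<in> carrier_mat n n" "det A \<noteq> 0"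
  obtains B where "B \<in> carrier_mat n n" "A * B = 1\<^sub>m n" "B * A = 1\<^sub>m n"
  using det_non_zero_imp_unit[OF assms, of "()"] unfolding Units_def ring_mat_def by auto

lemma invertible_mat_iff_det:
  fixes A :: "'k::field mat"
  assumes A: "A \<in> carrier_mat n n"
  shows "invertible_mat A \<longleftrightarrow> det A \<noteq> 0"
proof
  assume "invertible_mat A"
  then obtain B where B: "A * B = 1\<^sub>m n" "B * A = 1\<^sub>m (dim_row B)"
    using A unfolding invertible_mat_def inverts_mat_def by auto
  have "B \<in> carrier_mat n n"
    \<comment> \<open>\<open>invertible_mat\<close> leaves the shape of the inverse open; comparing
      column counts in the two products fixes it.\<close>
    using arg_cong[OF B(1), of dim_col] arg_cong[OF B(2), of dim_col] A by auto
  thus "det A \<noteq> 0" using det_mult[OF A, of B] B by auto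
next
  assume "det A \<noteq> 0"
  then obtain B where "B \<in> carrier_mat n n" "A * B = 1\<^sub>m n" "B * A = 1\<^sub>m n"
    using det_nonzero_inverse[OF A] by blast
  thus "invertible_mat A" using A unfolding invertible_mat_def inverts_mat_def by auto
qed

lemma det_nonzero_mult_vec_eq_0:
  fixes A :: "'k::field mat"
  assumes "A \<in> carrier_mat n n" "det A \<noteq> 0" "v \<in> carrier_vec n" "A *\<^sub>v v = 0\<^sub>v n"
  shows "v = 0\<^sub>v n"
  using assms det_0_iff_vec_prod_zero[of A n] by auto

text \<open>Families are indexed from 1 to d + 1, like the points of the theorem, while matrix rows
  start at 0; hence the shift by one here and in the lemmas below.\<close>

definition mat_with_rows :: "nat \<Rightarrow> (nat \<Rightarrow> 'k vec) \<Rightarrow> 'k mat" where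
  "mat_with_rows d X = mat (d + 1) (d + 1) (\<lambda>(i, k). X (i + 1) $ k)"

lemma mat_with_rows_carrier: "mat_with_rows d X \<in> carrier_mat (d + 1) (d + 1)"
  unfolding mat_with_rows_def by simp

lemma row_mat_with_rows:
  assumes "i \<in> {1..d + 1}" "X i \<in> carrier_vec (d + 1)"
  shows "row (mat_with_rows d X) (i - 1) = X i"
  using assms unfolding mat_with_rows_def by (intro eq_vecI) auto

lemma mat_with_rows_mult_vec:
  assumes "i \<in> {1..d + 1}" "X i \<in> carrier_vec (d + 1)"
  shows "(mat_with_rows d X *\<^sub>v u) $ (i - 1) = X i \<bullet> u"
proof -
  have "i - 1 < dim_row (mat_with_rows d X)" using assms unfolding mat_with_rows_def by auto
  thus ?thesis by (simp add: row_mat_with_rows[of i d X, OF assms, simplified])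
qed

text \<open>The matrix of all pairings of \<open>X\<close> with \<open>Y\<close> is diagonal with
  nonzero diagonal entries, and it is the product of the matrix of \<open>X\<close> with the
  transposed matrix of \<open>Y\<close>. So neither factor can be singular.\<close>

lemma det_biorthogonal:
  fixes X Y :: "nat \<Rightarrow> 'k::field vec"
  assumes X: "\<And>i. i \<in> {1..d + 1} \<Longrightarrow> X i \<in> carrier_vec (d + 1)"
    and Y: "\<And>i. i \<in> {1..d + 1} \<Longrightarrow> Y i \<in> carrier_vec (d + 1)"
    and XY: "\<And>i j. i \<in> {1..d + 1} \<Longrightarrow> j \<in> {1..d + 1} \<Longrightarrow> X i \<bullet> Y j = 0 \<longleftrightarrow> i \<noteq> j"
  shows "det (mat_with_rows d X) \<noteq> 0"
proof -
  let ?X = "mat_with_rows d X" and ?Y = "transpose_mat (mat_with_rows d Y)"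
  have cX: "?X \<in> carrier_mat (d + 1) (d + 1)" and cY: "?Y \<in> carrier_mat (d + 1) (d + 1)"
    using mat_with_rows_carrier by auto
  have entry: "(?X * ?Y) $$ (i, j) = X (i + 1) \<bullet> Y (j + 1)" if "i < d + 1" "j < d + 1" for i j
    using that cX cY row_mat_with_rows[of "i + 1" d X] row_mat_with_rows[of "j + 1" d Y] X Y
    by (auto simp: mat_with_rows_def)
  have dim: "dim_row (?X * ?Y) = d + 1" using cX by simp
  have "upper_triangular (?X * ?Y)"
    unfolding upper_triangular_def dim by (auto simp: entry XY simp del: index_mult_mat)
  hence "det (?X * ?Y) = prod_list (diag_mat (?X * ?Y))"
    using cX cY by (intro det_upper_triangular) auto
  also have "\<dots> \<noteq> 0"
    unfolding diag_mat_def dim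
    by (auto simp: prod_list_zero_iff entry XY simp del: index_mult_mat)
  finally show ?thesis using det_mult[OF cX cY] by auto
qed

text \<open>By \<open>det_biorthogonal\<close> the covectors \<open>X i\<close> form a basis of the
  dual space. Below, this reduces an identity of vectors to evaluating the corresponding forms at d
  + 1 parameters.\<close>

lemma biorthogonal_eqI:
  fixes X Y :: "nat \<Rightarrow> 'k::field vec"
  assumes X: "\<And>i. i \<in> {1..d + 1} \<Longrightarrow> X i \<in> carrier_vec (d + 1)"
    and Y: "\<And>i. i \<in> {1..d + 1} \<Longrightarrow> Y i \<in> carrier_vec (d + 1)"
    and XY: "\<And>i j. i \<in> {1..d + 1} \<Longrightarrow> j \<in> {1..d + 1} \<Longrightarrow> X i \<bullet> Y j = 0 \<longleftrightarrow> i \<noteq> j"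
    and u: "u \<in> carrier_vec (d + 1)" and v: "v \<in> carrier_vec (d + 1)"
    and eq: "\<And>i. i \<in> {1..d + 1} \<Longrightarrow> X i \<bullet> u = X i \<bullet> v"
  shows "u = v"
proof -
  let ?X = "mat_with_rows d X"
  have "?X *\<^sub>v u = ?X *\<^sub>v v"
  proof (rule eq_vecI)
    fix i assume "i < dim_vec (?X *\<^sub>v v)"
    hence "i + 1 \<in> {1..d + 1}" unfolding mat_with_rows_def by auto
    thus "(?X *\<^sub>v u) $ i = (?X *\<^sub>v v) $ i"
      using mat_with_rows_mult_vec[of "i + 1" d X] X eq by fastforce
  qed simp
  moreover obtain B where "B \<in> carrier_mat (d + 1) (d + 1)" "B * ?X = 1\<^sub>m (d + 1)"
    using det_nonzero_inverse[OF mat_with_rows_carrier det_biorthogonal[OF X Y XY]] by metis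
  ultimately show ?thesis
    by (metis assoc_mult_mat_vec mat_with_rows_carrier one_mult_mat_vec u v)
qed

section \<open>Brackets of parameters, Veronese vectors and osculating covectors\<close>

definition bracket :: "'k::comm_ring \<times> 'k \<Rightarrow> 'k \<times> 'k \<Rightarrow> 'k" where
  "bracket p q = fst p * snd q - fst q * snd p"

lemma bracket_swap: "bracket q p = - bracket p q"
  unfolding bracket_def by simp

lemma bracket_self [simp]: "bracket p p = 0"
  unfolding bracket_def by simp

definition osc_vec :: "nat \<Rightarrow> 'k::field \<times> 'k \<Rightarrow> 'k vec" where
  "osc_vec d p = vec (d + 1) (\<lambda>i. snd p ^ (d - i) * (- fst p) ^ i)"

abbreviation ver :: "nat \<Rightarrow> 'k::field \<times> 'k \<Rightarrow> 'k vec" where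
  "ver d p \<equiv> veronese_vec d (fst p) (snd p)"

lemma osc_vec_carrier: "osc_vec d p \<in> carrier_vec (d + 1)"
  unfolding osc_vec_def by simp

lemmas osc_vec_carrier_Suc [simp] = osc_vec_carrier[simplified]

lemma ver_carrier: "veronese_vec d a b \<in> carrier_vec (d + 1)"
  unfolding veronese_vec_def by simp

lemmas ver_carrier_Suc [simp] = ver_carrier[simplified]

text \<open>The binomial coefficients sit in \<open>veronese_vec\<close> only, so the pairing is
  term by term the binomial expansion of a power of the bracket. For d > 0 it vanishes exactly where
  the bracket does, which is why \<open>osc_vec d p\<close> cuts the curve in a single
  point.\<close>

lemma osc_vec_ver: "osc_vec d p \<bullet> ver d q = bracket q p ^ d"
proof -
  have "bracket q p ^ d = (- fst p * snd q + fst q * snd p) ^ d"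
    unfolding bracket_def by (simp add: algebra_simps)
  also have "\<dots> = (\<Sum>i\<le>d. of_nat (d choose i) * (- fst p * snd q) ^ i * (fst q * snd p) ^ (d - i))"
    by (rule binomial_ring)
  also have "\<dots> = (\<Sum>i\<in>{0..<d + 1}. osc_vec d p $ i * ver d q $ i)"
    unfolding osc_vec_def veronese_vec_def
    unfolding power_mult_distrib by (intro sum.cong) (auto simp: mult_ac)
  also have "\<dots> = osc_vec d p \<bullet> ver d q"
    unfolding scalar_prod_def veronese_vec_def by simp
  finally show ?thesis by simp
qed

lemma ex_bracket_nonzero:
  fixes p :: "'k::field \<times> 'k"
  assumes "p \<noteq> (0, 0)"
  obtains q where "bracket q p \<noteq> 0"
proof (cases "fst p = 0")
  case True
  thus ?thesis using assms that[of "(1, 0)"] by (auto simp: bracket_def prod_eq_iff)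
next
  case False
  thus ?thesis using that[of "(0, 1)"] by (auto simp: bracket_def)
qed

text \<open>The first and last entries have binomial coefficient 1, so no condition on the
  characteristic enters.\<close>

lemma ver_nonzero:
  assumes "p \<noteq> (0, 0)"
  shows "ver d p \<noteq> 0\<^sub>v (d + 1)"
proof
  assume "ver d p = 0\<^sub>v (d + 1)"
  moreover have "ver d p $ 0 = fst p ^ d" "ver d p $ d = snd p ^ d"
    unfolding veronese_vec_def by auto
  ultimately show False using assms by (auto simp: prod_eq_iff)
qed

lemma bracket_eq_0D:
  fixes p q :: "'k::field \<times> 'k"
  assumes "p \<noteq> (0, 0)" "q \<noteq> (0, 0)" "bracket p q = 0"
  obtains c where "c \<noteq> 0" "q = (c * fst p, c * snd p)"
proof (cases "fst p = 0")
  case True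
  thus ?thesis using assms that[of "snd q / snd p"]
    by (auto simp: bracket_def prod_eq_iff field_simps)
next
  case False
  hence "fst q \<noteq> 0" using assms by (auto simp: bracket_def prod_eq_iff)
  thus ?thesis using False assms that[of "fst q / fst p"]
    by (auto simp: bracket_def prod_eq_iff field_simps)
qed

lemma ver_scale: "veronese_vec d (c * a) (c * b) = c ^ d \<cdot>\<^sub>v veronese_vec d a b"
proof (rule eq_vecI)
  fix i assume "i < dim_vec (c ^ d \<cdot>\<^sub>v veronese_vec d a b)"
  hence "i \<le> d" unfolding veronese_vec_def by simp
  thus "veronese_vec d (c * a) (c * b) $ i = (c ^ d \<cdot>\<^sub>v veronese_vec d a b) $ i"
    using power_add[of c "d - i" i] unfolding veronese_vec_def
    by (simp add: power_mult_distrib mult_ac)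
qed (simp add: veronese_vec_def)

lemma bracket_eq_0_imp_same_point:
  assumes "p \<noteq> (0, 0)" "q \<noteq> (0, 0)" "bracket p q = 0"
  shows "proj_class (ver d p) = proj_class (ver d q)"
  using bracket_eq_0D[OF assms] by (metis fst_conv power_not_zero proj_class_smult snd_conv ver_scale)

text \<open>Pairing with \<open>osc_vec d q\<close> evaluates the form with coefficient vector
  \<open>w\<close> at x = \<open>snd q\<close>, y = \<open>- fst q\<close>. Every product of d
  linear forms therefore arises from some \<open>w\<close>; its coefficients are built one factor at
  a time.\<close>

lemma product_form:
  fixes p :: "'i \<Rightarrow> 'k::field \<times> 'k"
  assumes "finite J" "card J = d"
  obtains w where "w \<in> carrier_vec (d + 1)"
    "\<And>q. osc_vec d q \<bullet> w = (\<Prod>j\<in>J. bracket (p j) q)"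
proof -
  have "\<exists>f. \<forall>x y. (\<Sum>i\<le>card J. f i * (x ^ (card J - i) * y ^ i)) =
      (\<Prod>j\<in>J. fst (p j) * x + snd (p j) * y)"
    using assms(1)
  proof (induction J)
    case empty
    show ?case by (auto intro: exI[of _ "\<lambda>_. 1"])
  next
    case (insert j J)
    then obtain f where f: "\<And>x y. (\<Sum>i\<le>card J. f i * (x ^ (card J - i) * y ^ i)) =
      (\<Prod>j\<in>J. fst (p j) * x + snd (p j) * y)" by blast
    let ?n = "card J" and ?a = "fst (p j)" and ?b = "snd (p j)"
    \<comment> \<open>Coefficients after multiplication by \<open>?a * x + ?b * y\<close>: the first
      summand keeps the power of y, the second raises it by one. The case distinctions cut off the
      indices outside the old range.\<close>
    let ?g = "\<lambda>i. (if i \<le> ?n then ?a * f i else 0) + (if i = 0 then 0 else ?b * f (i - 1))"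
    have "(\<Sum>i\<le>Suc ?n. ?g i * (x ^ (Suc ?n - i) * y ^ i)) =
      (?a * x + ?b * y) * (\<Sum>i\<le>?n. f i * (x ^ (?n - i) * y ^ i))" for x y
    proof -
      have "(\<Sum>i\<le>Suc ?n. ?g i * (x ^ (Suc ?n - i) * y ^ i)) =
        (\<Sum>i\<le>Suc ?n. (if i \<le> ?n then ?a * f i else 0) * (x ^ (Suc ?n - i) * y ^ i)) +
        (\<Sum>i\<le>Suc ?n. (if i = 0 then 0 else ?b * f (i - 1)) * (x ^ (Suc ?n - i) * y ^ i))"
        by (simp only: distrib_right sum.distrib)
      also have "(\<Sum>i\<le>Suc ?n. (if i \<le> ?n then ?a * f i else 0) * (x ^ (Suc ?n - i) * y ^ i)) =
        ?a * x * (\<Sum>i\<le>?n. f i * (x ^ (?n - i) * y ^ i))"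
        by (simp add: sum_distrib_left Suc_diff_le mult_ac)
      also have "(\<Sum>i\<le>Suc ?n. (if i = 0 then 0 else ?b * f (i - 1)) * (x ^ (Suc ?n - i) * y ^ i)) =
        ?b * y * (\<Sum>i\<le>?n. f i * (x ^ (?n - i) * y ^ i))"
        by (subst sum.atMost_Suc_shift) (simp add: sum_distrib_left mult_ac)
      finally show ?thesis by (simp add: distrib_right)
    qed
    thus ?case using insert.hyps f by (intro exI[of _ ?g]) simp
  qed
  then obtain f where f: "\<And>x y. (\<Sum>i\<le>d. f i * (x ^ (d - i) * y ^ i)) =
      (\<Prod>j\<in>J. fst (p j) * x + snd (p j) * y)"
    using assms(2) by auto
  show ?thesis
  proof (rule that)
    show "vec (d + 1) f \<in> carrier_vec (d + 1)" by simp
    fix q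
    have "osc_vec d q \<bullet> vec (d + 1) f = (\<Sum>i\<le>d. f i * (snd q ^ (d - i) * (- fst q) ^ i))"
      unfolding osc_vec_def scalar_prod_def by (intro sum.cong) auto
    \<comment> \<open>At x = \<open>snd q\<close>, y = \<open>- fst q\<close> each linear factor
      becomes \<open>bracket (p j) q\<close>.\<close>
    thus "osc_vec d q \<bullet> vec (d + 1) f = (\<Prod>j\<in>J. bracket (p j) q)"
      unfolding f bracket_def by (simp add: mult_ac)
  qed
qed

section \<open>Uniqueness of the osculating covector\<close>

lemma of_nat_choose_nonzero:
  assumes "CHAR('k::field) = 0 \<or> CHAR('k) > d" "i \<le> d"
  shows "(of_nat (d choose i) :: 'k) \<noteq> 0"
proof -
  \<comment> \<open>All factors of d! are positive and below a nonzero characteristic, so d!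
    survives in the field, and \<open>d choose i\<close> divides d!.\<close>
  have "(of_nat (fact n) :: 'k) \<noteq> 0" if "n \<le> d" for n
    using that
  proof (induction n)
    case (Suc n)
    have "(of_nat (Suc n) :: 'k) \<noteq> 0"
      using assms(1) Suc.prems dvd_imp_le[of "CHAR('k)" "Suc n"]
      by (auto simp: of_nat_eq_0_iff_char_dvd simp del: of_nat_Suc)
    thus ?case using Suc by (simp only: fact_Suc of_nat_mult of_nat_id) simp
  qed simp
  from this[of d] show ?thesis
    using binomial_fact_lemma[OF assms(2)] by (metis mult_zero_right of_nat_0 of_nat_mult order_refl)
qed

text \<open>Once the full power of the linear factor at \<open>r\<close> is split off, the cofactor
  has no root at all, hence is constant over an algebraically closed field.\<close>

lemma poly_single_root:
  fixes f :: "'k::alg_closed_field poly"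
  assumes "f \<noteq> 0" "\<And>t. poly f t = 0 \<Longrightarrow> t = r"
  obtains c where "f = Polynomial.smult c ([:- r, 1:] ^ degree f)"
proof -
  obtain n q where q: "f = [:- r, 1:] ^ n * q" "\<not> [:- r, 1:] dvd q"
    using order_decomp[OF assms(1)] by blast
  have "poly q t \<noteq> 0" for t
  proof
    assume t: "poly q t = 0"
    hence "poly f t = 0" by (subst q(1)) simp
    thus False using assms(2) q(2) t by (auto simp: poly_eq_0_iff_dvd)
  qed
  hence "degree q = 0" using alg_closed_imp_poly_has_root[of q] by auto
  then obtain c where c: "q = [:c:]" by (auto elim: degree_eq_zeroE)
  moreover have "c \<noteq> 0" using q c by auto
  moreover have f: "f = Polynomial.smult c ([:- r, 1:] ^ n)"
    using q(1) c by simp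
  ultimately have "degree f = n" by (simp add: degree_linear_power)
  thus ?thesis using that[of c] f by metis
qed

text \<open>On the chart q = (1, t) the pairing with \<open>c\<close> is a polynomial
  \<open>F c\<close> in t. Its zeros can only lie at \<open>p\<close>, which forces it to be a
  multiple of the polynomial of \<open>osc_vec d p\<close>; comparing coefficients and cancelling
  the binomials gives the claim for vectors.\<close>

lemma osc_vec_unique:
  fixes c :: "'k::alg_closed_field vec"
  assumes char: "CHAR('k) = 0 \<or> CHAR('k) > d" and c: "c \<in> carrier_vec (d + 1)"
    and p: "p \<noteq> (0, 0)"
    and zeros: "\<And>q. q \<noteq> (0, 0) \<Longrightarrow> c \<bullet> ver d q = 0 \<Longrightarrow> bracket q p = 0"
  obtains k where "c = k \<cdot>\<^sub>v osc_vec d p"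
proof -
  define F where "F v = (\<Sum>i\<le>d. Polynomial.monom (of_nat (d choose i) * v $ i) i)" for v :: "'k vec"
  have coeff_F: "Polynomial.coeff (F v) i = of_nat (d choose i) * v $ i" if "i \<le> d" for v i
    using that unfolding F_def by (simp add: coeff_sum)
  have poly_F: "poly (F v) t = v \<bullet> veronese_vec d 1 t" if "v \<in> carrier_vec (d + 1)" for v t
    using that unfolding F_def veronese_vec_def scalar_prod_def
    by (auto simp: poly_sum poly_monom mult_ac lessThan_Suc_atMost atLeast0LessThan intro!: sum.cong)
  have deg_F: "degree (F v) \<le> d" for v
    unfolding F_def by (intro degree_sum_le) (auto intro: order_trans[OF degree_monom_le])
  have osc: "F (osc_vec d p) = [:snd p, - fst p:] ^ d"
  proof -
    have "[:snd p, - fst p:] ^ d = (Polynomial.monom (- fst p) 1 + [:snd p:]) ^ d"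
      by (simp add: monom_altdef)
    also have "\<dots> = (\<Sum>i\<le>d. of_nat (d choose i) * Polynomial.monom (- fst p) 1 ^ i * [:snd p:] ^ (d - i))"
      by (rule binomial_ring)
    also have "\<dots> = F (osc_vec d p)"
      unfolding F_def osc_vec_def
      by (intro sum.cong) (auto simp: monom_power poly_const_pow of_nat_poly smult_monom mult_ac)
    finally show ?thesis by simp
  qed
  have "\<exists>k. F c = Polynomial.smult k (F (osc_vec d p))"
  proof (cases "fst p = 0")
    \<comment> \<open>Here \<open>p\<close> is the point at infinity of the chart, so
      \<open>F c\<close> has no root and is constant.\<close>
    case True
    hence sp: "snd p \<noteq> 0" using p by (auto simp: prod_eq_iff)
    have "poly (F c) t \<noteq> 0" for t
      using zeros[of "(1, t)"] sp True c by (auto simp: poly_F bracket_def)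
    hence "degree (F c) = 0" using alg_closed_imp_poly_has_root[of "F c"] by auto
    then obtain e where "F c = [:e:]" by (auto elim: degree_eq_zeroE)
    thus ?thesis using sp True unfolding osc
      by (intro exI[of _ "e / snd p ^ d"]) (simp add: poly_const_pow)
  next
    case False
    let ?r = "snd p / fst p"
    \<comment> \<open>The value at infinity is the coefficient of t^d. As \<open>p\<close> is
      finite, it cannot vanish, so \<open>F c\<close> has full degree d and its only root has
      multiplicity d.\<close>
    have "c \<bullet> veronese_vec d 0 1 = c $ d"
      unfolding scalar_prod_def veronese_vec_def by (simp add: power_0_left)
    hence cd: "Polynomial.coeff (F c) d \<noteq> 0"
      using zeros[of "(0, 1)"] False by (auto simp: coeff_F bracket_def)
    hence deg: "degree (F c) = d" using deg_F[of c] le_degree by (metis le_antisym)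
    have "t = ?r" if "poly (F c) t = 0" for t
      using zeros[of "(1, t)"] False c that by (auto simp: poly_F bracket_def field_simps)
    then obtain e where e: "F c = Polynomial.smult e ([:- ?r, 1:] ^ d)"
      using poly_single_root[of "F c" ?r] cd deg by (metis coeff_0)
    have "[:snd p, - fst p:] = Polynomial.smult (- fst p) [:- ?r, 1:]" using False by simp
    hence "F (osc_vec d p) = Polynomial.smult ((- fst p) ^ d) ([:- ?r, 1:] ^ d)"
      unfolding osc by (simp only: smult_power)
    thus ?thesis using e False by (intro exI[of _ "e / (- fst p) ^ d"]) simp
  qed
  then obtain k where k: "F c = Polynomial.smult k (F (osc_vec d p))" by blast
  have "c = k \<cdot>\<^sub>v osc_vec d p"
  proof (rule eq_vecI)
    fix i assume "i < dim_vec (k \<cdot>\<^sub>v osc_vec d p)"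
    hence i: "i \<le> d" "i < dim_vec (osc_vec d p)" unfolding osc_vec_def by auto
    have "of_nat (d choose i) * c $ i = k * (of_nat (d choose i) * osc_vec d p $ i)"
      using arg_cong[OF k, of "\<lambda>f. Polynomial.coeff f i"] i by (simp add: coeff_F)
    thus "c $ i = (k \<cdot>\<^sub>v osc_vec d p) $ i"
      using of_nat_choose_nonzero[OF char i(1)] i by simp
  qed (use c in \<open>simp add: osc_vec_def\<close>)
  thus ?thesis by (rule that)
qed

section \<open>Osculating hyperplanes of a general rational normal curve and their
  intersections\<close>

lemma mem_image_standard_curve:
  fixes A :: "'k::field mat"
  assumes "A \<in> carrier_mat (d + 1) (d + 1)"
  shows "x \<in> (\<lambda>x. (\<lambda>v. A *\<^sub>v v) ` x) ` standard_rational_normal_curve d \<longleftrightarrow>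
    (\<exists>q. q \<noteq> (0, 0) \<and> x = proj_class (A *\<^sub>v ver d q))"
  unfolding standard_rational_normal_curve_def
  using image_proj_class[OF assms ver_carrier] by (auto simp: image_iff) blast+

text \<open>The covector of the standard curve is transported by \<open>A\<close>. Uniqueness, as
  \<open>THE\<close> demands, follows by pulling the covector of a competing hyperplane back to the
  standard curve and applying \<open>osc_vec_unique\<close>.\<close>

lemma osculating_hyperplane_image:
  fixes A :: "'k::alg_closed_field mat"
  assumes d: "d > 0" and char: "CHAR('k) = 0 \<or> CHAR('k) > d"
    and A: "A \<in> carrier_mat (d + 1) (d + 1)" "det A \<noteq> 0"
    and C: "C = (\<lambda>x. (\<lambda>v. A *\<^sub>v v) ` x) ` standard_rational_normal_curve d"
    and p: "p \<noteq> (0, 0)"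
  obtains a where "a \<in> carrier_vec (d + 1)"
    "osculating_hyperplane d C (proj_class (A *\<^sub>v ver d p)) = hyperplane d a"
    "\<And>u. u \<in> carrier_vec (d + 1) \<Longrightarrow> a \<bullet> (A *\<^sub>v u) = osc_vec d p \<bullet> u"
proof -
  obtain B where B: "B \<in> carrier_mat (d + 1) (d + 1)" "A * B = 1\<^sub>m (d + 1)" "B * A = 1\<^sub>m (d + 1)"
    using det_nonzero_inverse[OF A] by blast
  have BA: "B *\<^sub>v (A *\<^sub>v u) = u" if "u \<in> carrier_vec (d + 1)" for u
    using assoc_mult_mat_vec[OF B(1) A(1) that] B(3) that by simp
  have Au: "A *\<^sub>v u \<in> carrier_vec (d + 1)" if "u \<in> carrier_vec (d + 1)" for u
    using A(1) that by (rule mult_mat_vec_carrier)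
  have Au0: "A *\<^sub>v u \<noteq> 0\<^sub>v (d + 1)" if "u \<in> carrier_vec (d + 1)" "u \<noteq> 0\<^sub>v (d + 1)" for u
    using det_nonzero_mult_vec_eq_0[OF A that(1)] that(2) by blast
  \<comment> \<open>Covectors move by the inverse transpose, which keeps pairings unchanged.\<close>
  define a where "a = transpose_mat B *\<^sub>v osc_vec d p"
  have tA: "transpose_mat A \<in> carrier_mat (d + 1) (d + 1)"
    and tB: "transpose_mat B \<in> carrier_mat (d + 1) (d + 1)" using A B by auto
  have a: "a \<in> carrier_vec (d + 1)"
    unfolding a_def using tB osc_vec_carrier by (rule mult_mat_vec_carrier)
  have aA: "a \<bullet> (A *\<^sub>v u) = osc_vec d p \<bullet> u" if "u \<in> carrier_vec (d + 1)" for u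
    unfolding a_def using transpose_vec_mult_scalar[OF B(1) Au[OF that] osc_vec_carrier] BA[OF that]
    by simp
  have a0: "a \<noteq> 0\<^sub>v (d + 1)"
  proof
    assume "a = 0\<^sub>v (d + 1)"
    moreover obtain q where "bracket q p \<noteq> 0" using ex_bracket_nonzero[OF p] .
    ultimately show False
      using aA[OF ver_carrier, of "fst q" "snd q"] Au[OF ver_carrier, of "fst q" "snd q"]
      by (simp add: osc_vec_ver)
  qed
  have memC: "x \<in> C \<longleftrightarrow> (\<exists>q. q \<noteq> (0, 0) \<and> x = proj_class (A *\<^sub>v ver d q))" for x
    unfolding C using A(1) by (rule mem_image_standard_curve)
  let ?P = "proj_class (A *\<^sub>v ver d p)"
  have mem: "proj_class (A *\<^sub>v ver d q) \<in> hyperplane d a \<longleftrightarrow> bracket q p = 0" if "q \<noteq> (0, 0)" for q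
    using mem_hyperplane[OF a Au[OF ver_carrier] Au0[OF ver_carrier ver_nonzero[OF that]]]
      aA[OF ver_carrier] d by (simp add: osc_vec_ver)
  have "osculating_hyperplane d C ?P = hyperplane d a"
    unfolding osculating_hyperplane_def
  proof (rule the_equality)
    have "x = ?P" if x: "x \<in> hyperplane d a" "x \<in> C" for x
    proof -
      obtain q where q: "q \<noteq> (0, 0)" "x = proj_class (A *\<^sub>v ver d q)" using x memC by blast
      hence "proj_class (ver d q) = proj_class (ver d p)"
        using x mem p by (intro bracket_eq_0_imp_same_point) auto
      thus ?thesis using q image_proj_class[OF A(1) ver_carrier] by metis
    qed
    moreover have "?P \<in> hyperplane d a" using mem[OF p] by simp
    moreover have "?P \<in> C" using memC p by blast
    moreover have "is_hyperplane d (hyperplane d a)"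
      using a a0 unfolding is_hyperplane_def hyperplane_def by blast
    ultimately show "is_hyperplane d (hyperplane d a) \<and> hyperplane d a \<inter> C = {?P}" by blast
  next
    fix H assume H: "is_hyperplane d H \<and> H \<inter> C = {?P}"
    then obtain b where b: "b \<in> carrier_vec (d + 1)" "b \<noteq> 0\<^sub>v (d + 1)" "H = hyperplane d b"
      unfolding is_hyperplane_def hyperplane_def by blast
    define c where "c = transpose_mat A *\<^sub>v b"
    have c: "c \<in> carrier_vec (d + 1)"
      unfolding c_def using tA b(1) by (rule mult_mat_vec_carrier)
    have cA: "b \<bullet> (A *\<^sub>v u) = c \<bullet> u" if "u \<in> carrier_vec (d + 1)" for u
      unfolding c_def using transpose_vec_mult_scalar[OF A(1) that b(1)] by simp
    have "bracket q p = 0" if q: "q \<noteq> (0, 0)" "c \<bullet> ver d q = 0" for q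
    proof -
      have "proj_class (A *\<^sub>v ver d q) \<in> H"
        using mem_hyperplane[OF b(1) Au[OF ver_carrier] Au0[OF ver_carrier ver_nonzero[OF q(1)]]]
          cA[OF ver_carrier] q b(3) by simp
      hence "proj_class (A *\<^sub>v ver d q) = ?P" using H memC q(1) by blast
      \<comment> \<open>Pairing this proportionality with \<open>a\<close> gives
        \<open>bracket q p ^ d\<close> on the left and k times \<open>bracket p p ^ d\<close> = 0 on
        the right, using d > 0.\<close>
      then obtain k where "A *\<^sub>v ver d q = k \<cdot>\<^sub>v (A *\<^sub>v ver d p)" by (rule proj_class_eqD)
      hence "osc_vec d p \<bullet> ver d q = k * (osc_vec d p \<bullet> ver d p)"
        using aA[OF ver_carrier] scalar_prod_smult_distrib[OF a Au[OF ver_carrier]] by metis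
      thus ?thesis using d by (simp add: osc_vec_ver zero_power)
    qed
    then obtain k where k: "c = k \<cdot>\<^sub>v osc_vec d p" using osc_vec_unique[OF char c p] by blast
    have "transpose_mat B * transpose_mat A = 1\<^sub>m (d + 1)"
      using transpose_mult[OF A(1) B(1)] B(2) by simp
    hence "b = transpose_mat B *\<^sub>v c"
      unfolding c_def using assoc_mult_mat_vec[OF tB tA b(1)] b(1) by simp
    also have "\<dots> = k \<cdot>\<^sub>v a"
      unfolding k a_def using tB osc_vec_carrier by (rule mult_mat_vec)
    finally have bk: "b = k \<cdot>\<^sub>v a" .
    have "k \<noteq> 0" using bk b(2) a by auto
    thus "H = hyperplane d a" using b(3) bk hyperplane_smult[OF a] by simp
  qed
  thus ?thesis using that a aA by blast
qed

lemma bracket_nonzero_of_distinct: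
  assumes "p \<noteq> (0, 0)" "q \<noteq> (0, 0)" "A \<in> carrier_mat (d + 1) (d + 1)"
    "proj_class (A *\<^sub>v ver d p) \<noteq> proj_class (A *\<^sub>v ver d q)"
  shows "bracket p q \<noteq> 0"
  using bracket_eq_0_imp_same_point[OF assms(1,2)] image_proj_class[OF assms(3) ver_carrier] assms(4)
  by metis

text \<open>Up to nonzero scalars \<open>w\<close> is the basis dual to the osculating covectors.
  Lying on all hyperplanes but the i-th kills every coordinate in this basis except the
  i-th.\<close>

lemma osculating_simplex_vertex:
  fixes A :: "'k::alg_closed_field mat" and p :: "nat \<Rightarrow> 'k \<times> 'k"
  assumes d: "d > 0" and char: "CHAR('k) = 0 \<or> CHAR('k) > d"
    and A: "A \<in> carrier_mat (d + 1) (d + 1)" "det A \<noteq> 0"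
    and C: "C = (\<lambda>x. (\<lambda>v. A *\<^sub>v v) ` x) ` standard_rational_normal_curve d"
    and p: "\<And>i. i \<in> {1..d + 1} \<Longrightarrow> p i \<noteq> (0, 0)"
    and w: "\<And>i. i \<in> {1..d + 1} \<Longrightarrow> w i \<in> carrier_vec (d + 1)"
    and pw: "\<And>i j. i \<in> {1..d + 1} \<Longrightarrow> j \<in> {1..d + 1} \<Longrightarrow> osc_vec d (p i) \<bullet> w j = 0 \<longleftrightarrow> i \<noteq> j"
    and i: "i \<in> {1..d + 1}"
  shows "(\<Inter>j \<in> {1..d + 1} - {i}. osculating_hyperplane d C (proj_class (A *\<^sub>v ver d (p j)))) =
    {proj_class (A *\<^sub>v w i)}"
proof -
  let ?H = "\<lambda>j. osculating_hyperplane d C (proj_class (A *\<^sub>v ver d (p j)))"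
  obtain B where B: "B \<in> carrier_mat (d + 1) (d + 1)" "A * B = 1\<^sub>m (d + 1)"
    using det_nonzero_inverse[OF A] by blast
  have H: "?H j \<subseteq> proj_space d"
    "u \<in> carrier_vec (d + 1) \<Longrightarrow> u \<noteq> 0\<^sub>v (d + 1) \<Longrightarrow>
      proj_class (A *\<^sub>v u) \<in> ?H j \<longleftrightarrow> osc_vec d (p j) \<bullet> u = 0" if j: "j \<in> {1..d + 1}" for j u
  proof -
    obtain a where a: "a \<in> carrier_vec (d + 1)" "?H j = hyperplane d a"
      "\<And>u. u \<in> carrier_vec (d + 1) \<Longrightarrow> a \<bullet> (A *\<^sub>v u) = osc_vec d (p j) \<bullet> u"
      using osculating_hyperplane_image[OF d char A C p[OF j]] by blast
    show "?H j \<subseteq> proj_space d" unfolding a(2) hyperplane_def by blast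
    assume u: "u \<in> carrier_vec (d + 1)" "u \<noteq> 0\<^sub>v (d + 1)"
    show "proj_class (A *\<^sub>v u) \<in> ?H j \<longleftrightarrow> osc_vec d (p j) \<bullet> u = 0"
      using mem_hyperplane[OF a(1) mult_mat_vec_carrier[OF A(1) u(1)]]
        det_nonzero_mult_vec_eq_0[OF A u(1)] u(2) a(2) a(3)[OF u(1)] by auto
  qed
  have wi: "w i \<in> carrier_vec (d + 1)" "w i \<noteq> 0\<^sub>v (d + 1)"
    using w[OF i] pw[OF i i] osc_vec_carrier[of d "p i"] by auto
  have "x = proj_class (A *\<^sub>v w i)" if x: "x \<in> (\<Inter>j \<in> {1..d + 1} - {i}. ?H j)" for x
  proof -
    \<comment> \<open>Some hyperplane must actually occur, since an empty intersection would be
      \<open>UNIV\<close>; it guarantees that x is a projective point.\<close>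
    obtain j where j: "j \<in> {1..d + 1} - {i}"
    proof (cases "i = 1")
      case True thus ?thesis using that[of 2] d by auto
    next
      case False thus ?thesis using that[of 1] by auto
    qed
    hence "x \<in> proj_space d" using H(1) x by blast
    then obtain v where v: "v \<in> carrier_vec (d + 1)" "v \<noteq> 0\<^sub>v (d + 1)" "x = proj_class v"
      unfolding proj_space_def by blast
    define u where "u = B *\<^sub>v v"
    have u: "u \<in> carrier_vec (d + 1)" "v = A *\<^sub>v u"
      using B v(1) assoc_mult_mat_vec[OF A(1) B(1) v(1)] unfolding u_def by auto
    have u0: "u \<noteq> 0\<^sub>v (d + 1)" using v(2) u(2) A(1) by auto
    \<comment> \<open>The i-th pairing dictates this value; all other pairings vanish on both
      sides.\<close>
    define k where "k = (osc_vec d (p i) \<bullet> u) / (osc_vec d (p i) \<bullet> w i)"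
    have uk: "u = k \<cdot>\<^sub>v w i"
    proof (rule biorthogonal_eqI[of d "\<lambda>j. osc_vec d (p j)" w])
      fix j assume j: "j \<in> {1..d + 1}"
      have "osc_vec d (p j) \<bullet> u = k * (osc_vec d (p j) \<bullet> w i)"
      proof (cases "j = i")
        case True thus ?thesis using pw[OF i i] unfolding k_def by simp
      next
        case False
        thus ?thesis using x j pw[OF j i] H(2)[OF j u(1) u0] v(3) u(2) by auto
      qed
      thus "osc_vec d (p j) \<bullet> u = osc_vec d (p j) \<bullet> (k \<cdot>\<^sub>v w i)"
        using scalar_prod_smult_distrib[OF osc_vec_carrier wi(1)] by simp
    qed (use w pw u wi in auto)
    have "k \<noteq> 0" using uk u0 wi by auto
    moreover have "v = k \<cdot>\<^sub>v (A *\<^sub>v w i)" using uk u(2) mult_mat_vec[OF A(1) wi(1)] by simp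
    ultimately show ?thesis using v(3) proj_class_smult by simp
  qed
  moreover have "proj_class (A *\<^sub>v w i) \<in> ?H j" if "j \<in> {1..d + 1} - {i}" for j
    using H(2)[of j "w i"] that wi pw[of j i] i by auto
  ultimately show ?thesis by blast
qed

section \<open>The Bezoutian and the curve of osculating covectors\<close>

lemma product_form_dual:
  fixes p :: "nat \<Rightarrow> 'k::field \<times> 'k"
  assumes pw: "\<And>i q. i \<in> {1..d + 1} \<Longrightarrow>
      osc_vec d q \<bullet> w i = (\<Prod>j\<in>{1..d + 1} - {i}. bracket (p j) q)"
    and p_p: "\<And>i j. i \<in> {1..d + 1} \<Longrightarrow> j \<in> {1..d + 1} \<Longrightarrow> i \<noteq> j \<Longrightarrow> bracket (p i) (p j) \<noteq> 0"
    and ij: "i \<in> {1..d + 1}" "j \<in> {1..d + 1}"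
  shows "osc_vec d (p i) \<bullet> w j = 0 \<longleftrightarrow> i \<noteq> j"
proof -
  \<comment> \<open>Among the brackets with \<open>p i\<close> only the one at k = i is zero, and
    that factor is left out exactly when j = i.\<close>
  have "osc_vec d (p i) \<bullet> w j = 0 \<longleftrightarrow> (\<exists>k\<in>{1..d + 1} - {j}. bracket (p k) (p i) = 0)"
    unfolding pw[OF ij(2)] by (rule prod_zero_iff) simp
  thus ?thesis using p_p ij bracket_self[of "p i"] by blast
qed

text \<open>The matrix \<open>M\<close> is the Gram matrix of the Bezoutian of the forms with roots \<open>p\<close> and \<open>p'\<close>.
  To avoid dividing forms, it is determined by its values at the parameters \<open>p\<close>.\<close>

lemma bezoutian:
  fixes p p' :: "nat \<Rightarrow> 'k::field \<times> 'k"
  assumes w: "\<And>i. i \<in> {1..d + 1} \<Longrightarrow> w i \<in> carrier_vec (d + 1)"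
    and pw: "\<And>i q. i \<in> {1..d + 1} \<Longrightarrow>
      osc_vec d q \<bullet> w i = (\<Prod>j\<in>{1..d + 1} - {i}. bracket (p j) q)"
    and w': "\<And>i. i \<in> {1..d + 1} \<Longrightarrow> w' i \<in> carrier_vec (d + 1)"
    and pw': "\<And>i q. i \<in> {1..d + 1} \<Longrightarrow>
      osc_vec d q \<bullet> w' i = (\<Prod>j\<in>{1..d + 1} - {i}. bracket (p' j) q)"
    and p_p: "\<And>i j. i \<in> {1..d + 1} \<Longrightarrow> j \<in> {1..d + 1} \<Longrightarrow> i \<noteq> j \<Longrightarrow> bracket (p i) (p j) \<noteq> 0"
    and p_p': "\<And>i j. i \<in> {1..d + 1} \<Longrightarrow> j \<in> {1..d + 1} \<Longrightarrow> bracket (p i) (p' j) \<noteq> 0"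
  obtains M where "M \<in> carrier_mat (d + 1) (d + 1)" "det M \<noteq> 0"
    "\<And>i. i \<in> {1..d + 1} \<Longrightarrow> \<exists>k. k \<noteq> 0 \<and> M *\<^sub>v osc_vec d (p i) = k \<cdot>\<^sub>v w i"
    "\<And>i. i \<in> {1..d + 1} \<Longrightarrow> \<exists>k. k \<noteq> 0 \<and> M *\<^sub>v osc_vec d (p' i) = k \<cdot>\<^sub>v w' i"
proof -
  let ?I = "{1..d + 1}"
  \<comment> \<open>This is \<open>F'\<close> at \<open>p j\<close>. Since \<open>F\<close> vanishes
    there, setting x = \<open>p j\<close> in the Bezoutian leaves, up to sign, \<open>c j\<close>
    times the form of \<open>w j\<close>.\<close>
  define c where "c j = (\<Prod>n\<in>?I. bracket (p' n) (p j))" for j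
  have c0: "c j \<noteq> 0" if "j \<in> ?I" for j
    using p_p' that bracket_swap[of "p' _" "p j"] unfolding c_def by auto
  have dual: "osc_vec d (p i) \<bullet> w j = 0 \<longleftrightarrow> i \<noteq> j" if "i \<in> ?I" "j \<in> ?I" for i j
    using pw p_p that by (rule product_form_dual)
  \<comment> \<open>The rows of \<open>N\<close> are the prescribed values of the Bezoutian at x =
    \<open>p j\<close>, and \<open>L\<close> performs these evaluations. Both are invertible, so
    solving \<open>L * M = N\<close> defines a nonsingular \<open>M\<close>.\<close>
  define N where "N = mat_with_rows d (\<lambda>j. c j \<cdot>\<^sub>v w j)"
  define L where "L = mat_with_rows d (\<lambda>j. osc_vec d (p j))"
  have L: "L \<in> carrier_mat (d + 1) (d + 1)"
    unfolding L_def by (rule mat_with_rows_carrier)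
  have detL: "det L \<noteq> 0"
    unfolding L_def using osc_vec_carrier w dual by (rule det_biorthogonal)
  have wo: "w i \<bullet> osc_vec d q = osc_vec d q \<bullet> w i" if "i \<in> ?I" for i q
    using comm_scalar_prod[OF w[OF that] osc_vec_carrier] .
  have cwo: "(c i \<cdot>\<^sub>v w i) \<bullet> osc_vec d q = c i * (osc_vec d q \<bullet> w i)" if "i \<in> ?I" for i q
    using smult_scalar_prod_distrib[OF w[OF that] osc_vec_carrier] wo[OF that] by simp
  have N: "N \<in> carrier_mat (d + 1) (d + 1)"
    unfolding N_def by (rule mat_with_rows_carrier)
  have detN: "det N \<noteq> 0"
    unfolding N_def
    proof (rule det_biorthogonal[of d _ "\<lambda>j. osc_vec d (p j)"])
      fix i j assume ij: "i \<in> ?I" "j \<in> ?I"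
      show "(c i \<cdot>\<^sub>v w i) \<bullet> osc_vec d (p j) = 0 \<longleftrightarrow> i \<noteq> j"
        unfolding cwo[OF ij(1)] using dual[OF ij(2,1)] c0[OF ij(1)] by auto
    qed (use w in auto)
  obtain K where K: "K \<in> carrier_mat (d + 1) (d + 1)" "L * K = 1\<^sub>m (d + 1)"
    using det_nonzero_inverse[OF L detL] by blast
  define M where "M = K * N"
  have M: "M \<in> carrier_mat (d + 1) (d + 1)" unfolding M_def using K(1) N by simp
  have LM: "L * M = N" unfolding M_def
    using assoc_mult_mat[OF L K(1) N] K(2) N by simp
  have "det M \<noteq> 0" using det_mult[OF L M] LM detN by auto
  moreover
  have pM: "osc_vec d (p j) \<bullet> (M *\<^sub>v osc_vec d q) = c j * (osc_vec d q \<bullet> w j)" if j: "j \<in> ?I" for j q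
  proof -
    have "osc_vec d (p j) \<bullet> (M *\<^sub>v osc_vec d q) = (L *\<^sub>v (M *\<^sub>v osc_vec d q)) $ (j - 1)"
      unfolding L_def using mat_with_rows_mult_vec[OF j, of "\<lambda>j. osc_vec d (p j)"] by simp
    also have "\<dots> = (N *\<^sub>v osc_vec d q) $ (j - 1)"
      using assoc_mult_mat_vec[OF L M osc_vec_carrier] LM by simp
    also have "\<dots> = (c j \<cdot>\<^sub>v w j) \<bullet> osc_vec d q"
      unfolding N_def using mat_with_rows_mult_vec[OF j, of "\<lambda>j. c j \<cdot>\<^sub>v w j"] w[OF j] by simp
    finally show ?thesis using cwo[OF j] by simp
  qed
  have M_eqI: "M *\<^sub>v osc_vec d q = k \<cdot>\<^sub>v v"
    if v: "v \<in> carrier_vec (d + 1)"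
      and eq: "\<And>j. j \<in> ?I \<Longrightarrow> c j * (osc_vec d q \<bullet> w j) = k * (osc_vec d (p j) \<bullet> v)" for q k v
  proof (rule biorthogonal_eqI[of d "\<lambda>j. osc_vec d (p j)" w])
    fix j assume j: "j \<in> ?I"
    show "osc_vec d (p j) \<bullet> (M *\<^sub>v osc_vec d q) = osc_vec d (p j) \<bullet> (k \<cdot>\<^sub>v v)"
      unfolding pM[OF j] eq[OF j] using scalar_prod_smult_distrib[OF osc_vec_carrier v] by simp
  qed (use w dual v mult_mat_vec_carrier[OF M osc_vec_carrier] in auto)
  \<comment> \<open>Tested at \<open>p j\<close>, both sides vanish for j different from i and agree
    trivially for j = i.\<close>
  have "M *\<^sub>v osc_vec d (p i) = c i \<cdot>\<^sub>v w i" if i: "i \<in> ?I" for i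
  proof (rule M_eqI[OF w[OF i]])
    fix j assume j: "j \<in> ?I"
    show "c j * (osc_vec d (p i) \<bullet> w j) = c i * (osc_vec d (p j) \<bullet> w i)"
      using dual[OF i j] dual[OF j i] by (cases "i = j") auto
  qed
  \<comment> \<open>The scalar is minus \<open>F\<close> at \<open>p' i\<close>. Splitting the
    factor at \<open>p' i\<close> off \<open>c j\<close> and the factor at \<open>p j\<close> off
    this scalar leaves equal products; the two split factors differ by the sign of
    \<open>bracket_swap\<close>.\<close>
  moreover have "M *\<^sub>v osc_vec d (p' i) = (- (\<Prod>m\<in>?I. bracket (p m) (p' i))) \<cdot>\<^sub>v w' i"
    if i: "i \<in> ?I" for i
  proof (rule M_eqI[OF w'[OF i]])
    fix j assume j: "j \<in> ?I"
    show "c j * (osc_vec d (p' i) \<bullet> w j) =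
      - (\<Prod>m\<in>?I. bracket (p m) (p' i)) * (osc_vec d (p j) \<bullet> w' i)"
      unfolding pw[OF j] pw'[OF i] c_def
        prod.remove[OF finite_atLeastAtMost i, of "\<lambda>n. bracket (p' n) (p j)"]
        prod.remove[OF finite_atLeastAtMost j, of "\<lambda>m. bracket (p m) (p' i)"]
        bracket_swap[of "p' i" "p j"]
      by (simp add: mult_ac)
  qed
  moreover have "- (\<Prod>m\<in>?I. bracket (p m) (p' i)) \<noteq> 0" if "i \<in> ?I" for i
    using p_p' that by auto
  ultimately show ?thesis using that[OF M] c0 by metis
qed

text \<open>The osculating covectors themselves trace a rational normal curve: a diagonal matrix of
  inverse binomials removes the coefficients by which they differ from Veronese vectors with the
  parameter turned to (\<open>snd p\<close>, \<open>- fst p\<close>).\<close>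

lemma ver_to_osc_vec:
  assumes "CHAR('k::field) = 0 \<or> CHAR('k::field) > d"
  obtains S :: "'k::field mat" where "S \<in> carrier_mat (d + 1) (d + 1)" "det S \<noteq> 0"
    "\<And>p. S *\<^sub>v veronese_vec d (snd p) (- fst p) = osc_vec d p"
proof -
  define s :: "nat \<Rightarrow> 'k" where "s i = inverse (of_nat (d choose i))" for i
  define S where "S = mat (d + 1) (d + 1) (\<lambda>(i, j). if i = j then s i else 0)"
  have s: "s i * of_nat (d choose i) = 1" if "i \<le> d" for i
    using of_nat_choose_nonzero[OF assms that] unfolding s_def by simp
  have "S *\<^sub>v veronese_vec d (snd p) (- fst p) = osc_vec d p" for p
  proof (rule eq_vecI)
    fix i assume "i < dim_vec (osc_vec d p)"
    hence i: "i < d + 1" unfolding osc_vec_def by simp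
    let ?v = "veronese_vec d (snd p) (- fst p)"
    have "(S *\<^sub>v ?v) $ i = (\<Sum>j\<in>{0..<d + 1}. (if i = j then s i else 0) * ?v $ j)"
      using i unfolding S_def by (simp add: scalar_prod_def veronese_vec_def)
    also have "\<dots> = (\<Sum>j\<in>{0..<d + 1}. if i = j then s i * ?v $ j else 0)"
      by (intro sum.cong) auto
    also have "\<dots> = s i * ?v $ i" using i by (subst sum.delta') auto
    also have "\<dots> = s i * of_nat (d choose i) * osc_vec d p $ i"
      using i unfolding veronese_vec_def osc_vec_def by simp
    finally show "(S *\<^sub>v ?v) $ i = osc_vec d p $ i" using s i by simp
  qed (simp add: S_def osc_vec_def)
  moreover have S: "S \<in> carrier_mat (d + 1) (d + 1)" unfolding S_def by simp
  moreover have "det S \<noteq> 0"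
  proof -
    have "upper_triangular S" unfolding upper_triangular_def S_def by auto
    hence "det S = prod_list (diag_mat S)" using S by (rule det_upper_triangular)
    also have "\<dots> \<noteq> 0"
      using s unfolding diag_mat_def S_def
      by (auto simp: prod_list_zero_iff simp del: upt_Suc) (metis less_Suc_eq_le mult_zero_left zero_neq_one)
    finally show ?thesis .
  qed
  ultimately show ?thesis using that by blast
qed

section \<open>The rational normal curve through all vertices\<close>

theorem theorem3p1:
  fixes d :: nat
    and C :: "'k::alg_closed_field proj_point set"
    and P P' :: "nat \<Rightarrow> 'k proj_point"
  assumes "d \<ge> 2"
    and "CHAR('k) = 0 \<or> CHAR('k) > d"
    and "rational_normal_curve d C"
    and "\<And>i. i \<in> {1..d + 1} \<Longrightarrow> P i \<in> C"
    and "\<And>i. i \<in> {1..d + 1} \<Longrightarrow> P' i \<in> C"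
    and "inj_on P {1..d + 1}"
    and "inj_on P' {1..d + 1}"
    and "P ` {1..d + 1} \<inter> P' ` {1..d + 1} = {}"
  shows "\<exists>R R'.
    (\<forall>i \<in> {1..d + 1}.
       (\<Inter>j \<in> {1..d + 1} - {i}. osculating_hyperplane d C (P j)) = {R i} \<and>
       (\<Inter>j \<in> {1..d + 1} - {i}. osculating_hyperplane d C (P' j)) = {R' i}) \<and>
    (\<exists>D. rational_normal_curve d D \<and>
       (\<forall>i \<in> {1..d + 1}. R i \<in> D \<and> R' i \<in> D))"
proof -
  let ?I = "{1..d + 1}"
  have d: "d > 0" using assms(1) by simp
  obtain A where A: "A \<in> carrier_mat (d + 1) (d + 1)" "invertible_mat A"
    and C: "C = (\<lambda>x. (\<lambda>v. A *\<^sub>v v) ` x) ` standard_rational_normal_curve d"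
    using assms(3) unfolding rational_normal_curve_def is_proj_automorphism_def by blast
  have detA: "det A \<noteq> 0" using A(2) invertible_mat_iff_det[OF A(1)] by simp
  have param: "\<exists>p. \<forall>i\<in>?I. p i \<noteq> (0, 0) \<and> Q i = proj_class (A *\<^sub>v ver d (p i))"
    if "\<And>i. i \<in> ?I \<Longrightarrow> Q i \<in> C" for Q
    using that unfolding C mem_image_standard_curve[OF A(1)] by (intro bchoice) blast
  obtain p where p: "\<And>i. i \<in> ?I \<Longrightarrow> p i \<noteq> (0, 0)"
    and P: "\<And>i. i \<in> ?I \<Longrightarrow> P i = proj_class (A *\<^sub>v ver d (p i))"
    using param[of P] assms(4) by blast
  obtain p' where p': "\<And>i. i \<in> ?I \<Longrightarrow> p' i \<noteq> (0, 0)"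
    and P': "\<And>i. i \<in> ?I \<Longrightarrow> P' i = proj_class (A *\<^sub>v ver d (p' i))"
    using param[of P'] assms(5) by blast
  have p_p: "bracket (p i) (p j) \<noteq> 0" if "i \<in> ?I" "j \<in> ?I" "i \<noteq> j" for i j
    using bracket_nonzero_of_distinct[OF p[OF that(1)] p[OF that(2)] A(1)] that
      inj_onD[OF assms(6)] P by metis
  have p'_p': "bracket (p' i) (p' j) \<noteq> 0" if "i \<in> ?I" "j \<in> ?I" "i \<noteq> j" for i j
    using bracket_nonzero_of_distinct[OF p'[OF that(1)] p'[OF that(2)] A(1)] that
      inj_onD[OF assms(7)] P' by metis
  have p_p': "bracket (p i) (p' j) \<noteq> 0" if "i \<in> ?I" "j \<in> ?I" for i j
  proof (rule bracket_nonzero_of_distinct[OF p[OF that(1)] p'[OF that(2)] A(1)])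
    have "P i \<noteq> P' j" using assms(8) that by blast
    thus "proj_class (A *\<^sub>v ver d (p i)) \<noteq> proj_class (A *\<^sub>v ver d (p' j))"
      using P P' that by metis
  qed
  have product: "\<exists>w. \<forall>i\<in>?I. w i \<in> carrier_vec (d + 1) \<and>
      (\<forall>q. osc_vec d q \<bullet> w i = (\<Prod>j\<in>?I - {i}. bracket (r j) q))" for r :: "nat \<Rightarrow> 'k \<times> 'k"
  proof (rule bchoice, rule ballI)
    fix i assume "i \<in> ?I"
    hence "finite (?I - {i})" "card (?I - {i}) = d" by auto
    then obtain v where "v \<in> carrier_vec (d + 1)"
      "\<And>q. osc_vec d q \<bullet> v = (\<Prod>j\<in>?I - {i}. bracket (r j) q)"
      using product_form[of "?I - {i}" d r] by metis
    thus "\<exists>v. v \<in> carrier_vec (d + 1) \<and>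
        (\<forall>q. osc_vec d q \<bullet> v = (\<Prod>j\<in>?I - {i}. bracket (r j) q))"
      by blast
  qed
  obtain w where w: "\<And>i. i \<in> ?I \<Longrightarrow> w i \<in> carrier_vec (d + 1)"
    and pw: "\<And>i q. i \<in> ?I \<Longrightarrow> osc_vec d q \<bullet> w i = (\<Prod>j\<in>?I - {i}. bracket (p j) q)"
    using product[of p] by blast
  obtain w' where w': "\<And>i. i \<in> ?I \<Longrightarrow> w' i \<in> carrier_vec (d + 1)"
    and pw': "\<And>i q. i \<in> ?I \<Longrightarrow> osc_vec d q \<bullet> w' i = (\<Prod>j\<in>?I - {i}. bracket (p' j) q)"
    using product[of p'] by blast
  have dual: "osc_vec d (p i) \<bullet> w j = 0 \<longleftrightarrow> i \<noteq> j" if "i \<in> ?I" "j \<in> ?I" for i j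
    using pw p_p that by (rule product_form_dual)
  have dual': "osc_vec d (p' i) \<bullet> w' j = 0 \<longleftrightarrow> i \<noteq> j" if "i \<in> ?I" "j \<in> ?I" for i j
    using pw' p'_p' that by (rule product_form_dual)
  define R where "R i = proj_class (A *\<^sub>v w i)" for i
  define R' where "R' i = proj_class (A *\<^sub>v w' i)" for i
  have R: "(\<Inter>j \<in> ?I - {i}. osculating_hyperplane d C (P j)) = {R i}" if "i \<in> ?I" for i
    using osculating_simplex_vertex[OF d assms(2) A(1) detA C p w dual that] P
    unfolding R_def by auto
  have R': "(\<Inter>j \<in> ?I - {i}. osculating_hyperplane d C (P' j)) = {R' i}" if "i \<in> ?I" for i
    using osculating_simplex_vertex[OF d assms(2) A(1) detA C p' w' dual' that] P'
    unfolding R'_def by auto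
  obtain M where M: "M \<in> carrier_mat (d + 1) (d + 1)" "det M \<noteq> 0"
    "\<And>i. i \<in> ?I \<Longrightarrow> \<exists>k. k \<noteq> 0 \<and> M *\<^sub>v osc_vec d (p i) = k \<cdot>\<^sub>v w i"
    "\<And>i. i \<in> ?I \<Longrightarrow> \<exists>k. k \<noteq> 0 \<and> M *\<^sub>v osc_vec d (p' i) = k \<cdot>\<^sub>v w' i"
    using bezoutian[OF w pw w' pw' p_p p_p'] by blast
  obtain S :: "'k mat" where S: "S \<in> carrier_mat (d + 1) (d + 1)" "det S \<noteq> 0"
    "\<And>p. S *\<^sub>v veronese_vec d (snd p) (- fst p) = osc_vec d p"
    using ver_to_osc_vec[OF assms(2)] by blast
  \<comment> \<open>\<open>S\<close> turns Veronese vectors into osculating covectors,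
    \<open>M\<close> sends these to the Bezoutian with y fixed, and \<open>A\<close> returns to the
    coordinates of \<open>C\<close>. The curve \<open>D\<close> below is thus swept out as y
    varies.\<close>
  define T where "T = A * (M * S)"
  have MS: "M * S \<in> carrier_mat (d + 1) (d + 1)" using M(1) S(1) by simp
  have T: "T \<in> carrier_mat (d + 1) (d + 1)" unfolding T_def using A(1) MS by simp
  have "det T \<noteq> 0"
    unfolding T_def using det_mult[OF A(1) MS] det_mult[OF M(1) S(1)] detA M(2) S(2) by simp
  hence "invertible_mat T" using invertible_mat_iff_det[OF T] by simp
  define D where "D = (\<lambda>x. (\<lambda>v. T *\<^sub>v v) ` x) ` standard_rational_normal_curve d"
  have D: "rational_normal_curve d D"
    unfolding rational_normal_curve_def is_proj_automorphism_def D_def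
    using T \<open>invertible_mat T\<close> by blast
  \<comment> \<open>Proportionality is enough because the scalar \<open>k\<close> disappears in the
    projective class; the same fact serves \<open>w\<close> at \<open>p\<close> and
    \<open>w'\<close> at \<open>p'\<close>.\<close>
  have memD: "proj_class (A *\<^sub>v v) \<in> D"
    if q: "q \<noteq> (0, 0)" and k: "k \<noteq> 0" "M *\<^sub>v osc_vec d q = k \<cdot>\<^sub>v v"
      and v: "v \<in> carrier_vec (d + 1)" for q k v
  proof -
    let ?u = "veronese_vec d (snd q) (- fst q)"
    have "proj_class (T *\<^sub>v ?u) \<in> D"
      unfolding D_def mem_image_standard_curve[OF T] using q
      by (intro exI[of _ "(snd q, - fst q)"]) (auto simp: prod_eq_iff)
    moreover have "T *\<^sub>v ?u = A *\<^sub>v (M *\<^sub>v (S *\<^sub>v ?u))"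
      unfolding T_def using assoc_mult_mat_vec[OF A(1) MS ver_carrier]
        assoc_mult_mat_vec[OF M(1) S(1) ver_carrier] by metis
    moreover have "\<dots> = k \<cdot>\<^sub>v (A *\<^sub>v v)"
      using S(3) k(2) mult_mat_vec[OF A(1) v] by metis
    ultimately show ?thesis using proj_class_smult[OF k(1)] by metis
  qed
  have "R i \<in> D \<and> R' i \<in> D" if "i \<in> ?I" for i
    unfolding R_def R'_def using memD p p' w w' M(3,4) that by metis
  thus ?thesis
    using R R' D by (intro exI[of _ R] exI[of _ R'] conjI ballI exI[of _ D]) simp_all
qed

end
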